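(* Let $\{\mathbf{w}_r^n(t)\}_{r=1}^R{}_{n=1}^N$, $t\ge 0$, be weight vectors evolving by gradient flow on the tensor factorization objective $\phi$ associated with the tensor completion loss $\mathcal{L}$, and let $\mathcal{W}_e(t)=\sum_{r=1}^R \mathbf{w}_r^1(t)\otimes\cdots\otimes\mathbf{w}_r^N(t)$ be the end tensor at time $t$. Assume that the initial weight vectors $\{\mathbf{w}_r^n(0)\}_{r,n}$ have unbalancedness magnitude $\epsilon\ge 0$. Then, for any $r\in\{1,\ldots,R\}$ and any time $t\ge 0$ at which $\|\otimes_{n=1}^N\mathbf{w}_r^n(t)\|>0$, writing $\widehat{\mathbf{w}}_r^n(t):=\mathbf{w}_r^n(t)/\|\mathbf{w}_r^n(t)\|$ for $n=1,\ldots,N$ and $$\gamma_r(t):=\big\langle -\nabla\mathcal{L}(\mathcal{W}_e(t)),\ \otimes_{n=1}^N\widehat{\mathbf{w}}_r^n(t)\big\rangle ,$$ the following hold. (1) If $\gamma_r(t)\ge 0$, then $$\frac{d}{dt}\|\otimes_{n=1}^N\mathbf{w}_r^n(t)\|\le N\gamma_r(t)\Big(\|\otimes_{n=1}^N\mathbf{w}_r^n(t)\|^{\frac{2}{N}}+\epsilon\Big)^{N-1},\qquad \frac{d}{dt}\|\otimes_{n=1}^N\mathbf{w}_r^n(t)\|\ge N\gamma_r(t)\cdot\frac{\|\otimes_{n=1}^N\mathbf{w}_r^n(t)\|^2}{\|\otimes_{n=1}^N\mathbf{w}_r^n(t)\|^{\frac{2}{N}}+\epsilon}.$$ (2) If $\gamma_r(t)<0$,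 then $$\frac{d}{dt}\|\otimes_{n=1}^N\mathbf{w}_r^n(t)\|\ge N\gamma_r(t)\Big(\|\otimes_{n=1}^N\mathbf{w}_r^n(t)\|^{\frac{2}{N}}+\epsilon\Big)^{N-1},\qquad \frac{d}{dt}\|\otimes_{n=1}^N\mathbf{w}_r^n(t)\|\le N\gamma_r(t)\cdot\frac{\|\otimes_{n=1}^N\mathbf{w}_r^n(t)\|^2}{\|\otimes_{n=1}^N\mathbf{w}_r^n(t)\|^{\frac{2}{N}}+\epsilon}.$$
   Context: Fix integers $N\ge 3$, $d_1,\ldots,d_N\ge 1$, $R\ge 1$. $\mathbb{R}^{d_1,\ldots,d_N}$ is the space of order-$N$ real tensors with mode dimensions $d_1,\ldots,d_N$; $\langle\cdot,\cdot\rangle$ and $\|\cdot\|$ denote the Euclidean (Frobenius) inner product and norm. For $\mathbf{w}^n\in\mathbb{R}^{d_n}$, the outer product $\otimes_{n=1}^N\mathbf{w}^n=\mathbf{w}^1\otimes\cdots\otimes\mathbf{w}^N$ is the tensor with entries $[\otimes_{n=1}^N\mathbf{w}^n]_{i_1,\ldots,i_N}=\prod_{n=1}^N[\mathbf{w}^n]_{i_n}$. Tensor completion loss: given a non-empty set $\Omega$ of index tuples $(i_1,\ldots,i_N)$ and observations $y_{i_1,\ldots,i_N}\in\mathbb{R}$ for $(i_1,\ldots,i_N)\in\Omega$, $$\mathcal{L}:\mathbb{R}^{d_1,\ldots,d_N}\to\mathbb{R}_{\ge 0},\qquad \mathcal{L}(\mathcal{W})=\frac{1}{|\Omega|}\sum_{(i_1,\ldots,i_N)\in\Omega}\ell\big([\mathcal{W}]_{i_1,\ldots,i_N}-y_{i_1,\ldots,i_N}\big),$$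 where $\ell:\mathbb{R}\to\mathbb{R}_{\ge 0}$ is differentiable and locally smooth (its derivative is locally Lipschitz). Tensor factorization objective: for weight vectors $\mathbf{w}_r^n\in\mathbb{R}^{d_n}$, $\phi(\{\mathbf{w}_r^n\}_{r,n}):=\mathcal{L}(\mathcal{W}_e)$ with end tensor $\mathcal{W}_e:=\sum_{r=1}^R\mathbf{w}_r^1\otimes\cdots\otimes\mathbf{w}_r^N$. Gradient flow: $\frac{d}{dt}\mathbf{w}_r^n(t)=-\frac{\partial}{\partial\mathbf{w}_r^n}\phi(\{\mathbf{w}_{r'}^{n'}(t)\}_{r',n'})$ for all $t\ge 0$, $r=1,\ldots,R$, $n=1,\ldots,N$. The unbalancedness magnitude of weight vectors $\{\mathbf{w}_r^n\}_{r,n}$ is $\max_{r\in\{1,\ldots,R\},\ n,\bar n\in\{1,\ldots,N\}}\big|\|\mathbf{w}_r^n\|^2-\|\mathbf{w}_r^{\bar n}\|^2\big|$. *)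

theory Defs
  imports "HOL-Analysis.Analysis"
begin

text \<open>
  The order \<open>N\<close> and the dimensions \<open>d 1, \<dots>, d N\<close> are arbitrary numbers, so vectors of dimension
  \<open>m\<close> are functions on \<open>nat\<close> read only on \<open>{1..m}\<close>, and tensors are functions on multi-indices
  read only on \<open>multi_indices N d\<close>. A family of weight vectors \<open>w\<close> has entries \<open>w r n i\<close>, where
  \<open>r\<close> is the component, \<open>n\<close> the mode and \<open>i\<close> the coordinate.
\<close>

type_synonym vect = "nat \<Rightarrow> real"
type_synonym tensor = "(nat \<Rightarrow> nat) \<Rightarrow> real"
type_synonym weights = "nat \<Rightarrow> nat \<Rightarrow> vect"

definition multi_indices :: "nat \<Rightarrow> (nat \<Rightarrow> nat) \<Rightarrow> (nat \<Rightarrow> nat) set" where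
  "multi_indices N d = (\<Pi>\<^sub>E n\<in>{1..N}. {1..d n})"

definition vec_norm :: "nat \<Rightarrow> vect \<Rightarrow> real" where
  "vec_norm m v = L2_set v {1..m}"

definition tensor_inner :: "nat \<Rightarrow> (nat \<Rightarrow> nat) \<Rightarrow> tensor \<Rightarrow> tensor \<Rightarrow> real" where
  "tensor_inner N d V W = (\<Sum>i\<in>multi_indices N d. V i * W i)"

definition tensor_norm :: "nat \<Rightarrow> (nat \<Rightarrow> nat) \<Rightarrow> tensor \<Rightarrow> real" where
  "tensor_norm N d W = L2_set W (multi_indices N d)"

definition outer_product :: "nat \<Rightarrow> (nat \<Rightarrow> vect) \<Rightarrow> tensor" where
  "outer_product N v = (\<lambda>i. \<Prod>n=1..N. v n (i n))"

definition normalize_vecs :: "(nat \<Rightarrow> nat) \<Rightarrow> (nat \<Rightarrow> vect) \<Rightarrow> nat \<Rightarrow> vect" where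
  "normalize_vecs d v = (\<lambda>n i. v n i / vec_norm (d n) (v n))"

definition locally_smooth :: "(real \<Rightarrow> real) \<Rightarrow> bool" where
  "locally_smooth l \<longleftrightarrow>
     (\<forall>x. l differentiable (at x)) \<and>
     (\<forall>x. \<exists>e>0. \<exists>K. K-lipschitz_on (ball x e) (deriv l))"

definition completion_loss ::
    "(real \<Rightarrow> real) \<Rightarrow> (nat \<Rightarrow> nat) set \<Rightarrow> tensor \<Rightarrow> tensor \<Rightarrow> real" where
  "completion_loss l \<Omega> y W = 1 / real (card \<Omega>) * (\<Sum>i\<in>\<Omega>. l (W i - y i))"

text \<open>
  Gradients are taken entrywise, as partial derivatives. For differentiable \<open>l\<close> these all exist for
  the loss and for the factorization objective, so \<open>deriv\<close> is a genuine derivative there.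
\<close>

definition tensor_gradient :: "(tensor \<Rightarrow> real) \<Rightarrow> tensor \<Rightarrow> tensor" where
  "tensor_gradient L W = (\<lambda>i. deriv (\<lambda>x. L (W(i := x))) (W i))"

definition end_tensor :: "nat \<Rightarrow> nat \<Rightarrow> weights \<Rightarrow> tensor" where
  "end_tensor N R w = (\<lambda>i. \<Sum>r=1..R. outer_product N (w r) i)"

definition factorization_objective ::
    "nat \<Rightarrow> nat \<Rightarrow> (tensor \<Rightarrow> real) \<Rightarrow> weights \<Rightarrow> real" where
  "factorization_objective N R L w = L (end_tensor N R w)"

definition weight_gradient :: "(weights \<Rightarrow> real) \<Rightarrow> weights \<Rightarrow> nat \<Rightarrow> nat \<Rightarrow> vect" where
  "weight_gradient \<phi> w r n =
     (\<lambda>i. deriv (\<lambda>x. \<phi> (w(r := (w r)(n := (w r n)(i := x))))) (w r n i))"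

text \<open>The derivative at time 0 is one-sided.\<close>

definition gradient_flow ::
    "nat \<Rightarrow> (nat \<Rightarrow> nat) \<Rightarrow> nat \<Rightarrow> (weights \<Rightarrow> real) \<Rightarrow> (real \<Rightarrow> weights) \<Rightarrow> bool" where
  "gradient_flow N d R \<phi> w \<longleftrightarrow>
     (\<forall>t\<ge>0. \<forall>r\<in>{1..R}. \<forall>n\<in>{1..N}. \<forall>i\<in>{1..d n}.
        ((\<lambda>s. w s r n i) has_real_derivative - weight_gradient \<phi> (w t) r n i)
          (at t within {0..}))"

definition unbalancedness :: "nat \<Rightarrow> (nat \<Rightarrow> nat) \<Rightarrow> nat \<Rightarrow> weights \<Rightarrow> real" where
  "unbalancedness N d R w =
     Max {\<bar>(vec_norm (d n) (w r n))\<^sup>2 - (vec_norm (d m) (w r m))\<^sup>2\<bar> | r n m.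
            r \<in> {1..R} \<and> n \<in> {1..N} \<and> m \<in> {1..N}}"

definition component_norm :: "nat \<Rightarrow> (nat \<Rightarrow> nat) \<Rightarrow> weights \<Rightarrow> nat \<Rightarrow> real" where
  "component_norm N d w r = tensor_norm N d (outer_product N (w r))"

text \<open>
  The quantity \<open>\<gamma>\<^sub>r\<close>: inner product of the negative loss gradient at the end tensor with the
  normalized \<open>r\<close>-th component.
\<close>

definition alignment ::
    "nat \<Rightarrow> (nat \<Rightarrow> nat) \<Rightarrow> nat \<Rightarrow> (tensor \<Rightarrow> real) \<Rightarrow> weights \<Rightarrow> nat \<Rightarrow> real" where
  "alignment N d R L w r =
     tensor_inner N d (\<lambda>i. - tensor_gradient L (end_tensor N R w) i)
       (outer_product N (normalize_vecs d (w r)))"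

end

theory Submission
  imports Defs
begin

text \<open>
  Let \<open>G\<close> be the loss gradient at the end tensor. Since the end tensor is affine in each single
  weight vector, the inner product of \<open>w r n\<close> with its velocity is \<open>-\<langle>G, \<Otimes>\<^sub>m w r m\<rangle>\<close>, the same for
  every mode \<open>n\<close>. Hence the differences of the squared mode norms \<open>a n ^ 2\<close> are conserved, and the
  product \<open>P\<close> of the mode norms, which is the norm of the component, satisfies
  \<open>P' = \<gamma> * (\<Sum>n. (\<Prod>m\<noteq>n. a m) ^ 2)\<close>. The smallest \<open>a n ^ 2\<close> is at most \<open>P powr (2 / N)\<close>, so all of
  them are at most \<open>P powr (2 / N) + eps\<close>, which bounds each summand from above, and from below
  because \<open>\<Prod>m\<noteq>n. a m\<close> equals \<open>P / a n\<close>.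
\<close>

section \<open>Norms and outer products\<close>

lemma finite_multi_indices: "finite (multi_indices N d)"
  unfolding multi_indices_def by (intro finite_PiE) auto

lemma vec_norm_nonneg: "0 \<le> vec_norm m v"
  by (simp add: vec_norm_def)

lemma vec_norm_sq: "(vec_norm m v)\<^sup>2 = (\<Sum>j=1..m. (v j)\<^sup>2)"
  by (simp add: vec_norm_def L2_set_def sum_nonneg)

text \<open>Distributivity (\<open>prod_sum_PiE\<close>) turns the sum over multi-indices of a
  product of squares into a product of sums, one for each mode.\<close>

lemma tensor_norm_outer_product:
  "tensor_norm N d (outer_product N v) = (\<Prod>n=1..N. vec_norm (d n) (v n))"
proof -
  have "(\<Sum>i\<in>multi_indices N d. (outer_product N v i)\<^sup>2) = (\<Prod>n=1..N. \<Sum>j=1..d n. (v n j)\<^sup>2)"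
    unfolding multi_indices_def outer_product_def
    by (subst prod_sum_PiE) (auto simp: prod_power_distrib)
  also have "\<dots> = (\<Prod>n=1..N. vec_norm (d n) (v n))\<^sup>2"
    by (simp add: vec_norm_sq prod_power_distrib)
  finally show ?thesis
    unfolding tensor_norm_def L2_set_def by (simp add: prod_nonneg vec_norm_nonneg)
qed

lemma outer_product_normalize_vecs:
  "outer_product N (normalize_vecs d v) i = outer_product N v i / (\<Prod>n=1..N. vec_norm (d n) (v n))"
  unfolding outer_product_def normalize_vecs_def by (rule prod_dividef)

section \<open>Gradients of the loss and of the factorization objective\<close>

lemma has_derivative_outer_product_entry:
  assumes "n \<in> {1..N}"
  shows "((\<lambda>x. outer_product N (v(n := (v n)(j := x))) i) has_real_derivative
           (if i n = j then \<Prod>m\<in>{1..N}-{n}. v m (i m) else 0)) (at x)"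
proof -
  let ?c = "\<Prod>m\<in>{1..N}-{n}. v m (i m)"
  \<comment> \<open>The entry is affine in \<open>x\<close>: only the factor of mode
    \<open>n\<close> can change, and only when the multi-index reads coordinate \<open>j\<close>
    there.\<close>
  have "outer_product N (v(n := (v n)(j := x))) i = (if i n = j then x else v n (i n)) * ?c" for x
    unfolding outer_product_def using assms by (subst prod.remove[of _ n]) auto
  then show ?thesis
    by (auto intro!: derivative_eq_intros)
qed

text \<open>The varied coordinate occurs only in the summand \<open>r\<close>; all other components
  add up to a constant.\<close>

lemma has_derivative_end_tensor_entry:
  assumes "n \<in> {1..N}" "r \<in> {1..R}"
  shows "((\<lambda>x. end_tensor N R (w(r := (w r)(n := (w r n)(j := x)))) i) has_real_derivative
           (if i n = j then \<Prod>m\<in>{1..N}-{n}. w r m (i m) else 0)) (at x)"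
proof -
  let ?u = "\<lambda>x. (w r)(n := (w r n)(j := x))"
  have "end_tensor N R (w(r := ?u x)) i =
      outer_product N (?u x) i + (\<Sum>q\<in>{1..R}-{r}. outer_product N (w q) i)" for x
    unfolding end_tensor_def using assms(2) by (subst sum.remove[of _ r]) auto
  then show ?thesis
    using DERIV_add[OF has_derivative_outer_product_entry[OF assms(1), of "w r" j i x] DERIV_const]
    by (simp only: add_0_right)
qed

text \<open>Chain rule along an arbitrary curve of tensors. It serves twice below: for a curve
  varying one tensor entry, and for the end tensor as one weight coordinate varies.\<close>

lemma has_derivative_completion_loss:
  assumes "\<And>x. l differentiable (at x)"
    and "\<And>i. i \<in> \<Omega> \<Longrightarrow> ((\<lambda>x. W x i) has_real_derivative W' i) (at x)"
  shows "((\<lambda>x. completion_loss l \<Omega> y (W x)) has_real_derivative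
           1 / real (card \<Omega>) * (\<Sum>i\<in>\<Omega>. deriv l (W x i - y i) * W' i)) (at x)"
proof -
  have "((\<lambda>x. l (W x i - y i)) has_real_derivative deriv l (W x i - y i) * W' i) (at x)"
    if "i \<in> \<Omega>" for i
  proof -
    have "(l has_real_derivative deriv l (W x i - y i)) (at (W x i - y i))"
      using assms(1) by (simp add: DERIV_deriv_iff_real_differentiable)
    moreover have "((\<lambda>x. W x i - y i) has_real_derivative W' i) (at x)"
      using DERIV_diff[OF assms(2)[OF that] DERIV_const[of "y i"]] by simp
    ultimately show ?thesis by (rule DERIV_chain2)
  qed
  then show ?thesis
    unfolding completion_loss_def by (intro DERIV_cmult DERIV_sum) auto
qed

text \<open>Only the summand at \<open>k\<close> feels a change of that entry. The zero value off
  \<open>\<Omega>\<close> is what later allows sums over all multi-indices.\<close>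

lemma tensor_gradient_completion_loss:
  assumes "\<And>x. l differentiable (at x)" and "finite \<Omega>"
  shows "tensor_gradient (completion_loss l \<Omega> y) W k =
           (if k \<in> \<Omega> then 1 / real (card \<Omega>) * deriv l (W k - y k) else 0)"
proof -
  have "((\<lambda>x. (W(k := x)) i) has_real_derivative (if i = k then 1 else 0)) (at x)" for i x
    by auto
  from has_derivative_completion_loss[where W = "\<lambda>x. W(k := x)" and x = "W k", OF assms(1) this,
      of \<Omega> y]
  have "tensor_gradient (completion_loss l \<Omega> y) W k =
      1 / real (card \<Omega>) * (\<Sum>i\<in>\<Omega>. deriv l (W i - y i) * (if i = k then 1 else 0))"
    unfolding tensor_gradient_def fun_upd_triv by (rule DERIV_imp_deriv)
  also have "\<dots> = (if k \<in> \<Omega> then 1 / real (card \<Omega>) * deriv l (W k - y k) else 0)"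
    using assms(2) by (simp add: if_distrib[of "\<lambda>x. _ * x"] cong: if_cong)
  finally show ?thesis .
qed

text \<open>Chain rule through the end tensor, arranged so that the loss gradient appears as a
  factor ready for \<open>tensor_inner\<close>.\<close>

lemma weight_gradient_factorization_objective:
  assumes "\<And>x. l differentiable (at x)" and "\<Omega> \<subseteq> multi_indices N d"
    and "n \<in> {1..N}" "r \<in> {1..R}"
  shows "weight_gradient (factorization_objective N R (completion_loss l \<Omega> y)) w r n j =
           (\<Sum>i\<in>multi_indices N d. tensor_gradient (completion_loss l \<Omega> y) (end_tensor N R w) i *
              (if i n = j then \<Prod>m\<in>{1..N}-{n}. w r m (i m) else 0))"
    (is "_ = (\<Sum>i\<in>_. _ * ?c i)")
proof -
  have fin: "finite \<Omega>"
    using assms(2) finite_multi_indices finite_subset by blast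
  from has_derivative_completion_loss[OF assms(1)
      has_derivative_end_tensor_entry[OF assms(3,4), of w j _ "w r n j"], of \<Omega> y]
  have "weight_gradient (factorization_objective N R (completion_loss l \<Omega> y)) w r n j =
      1 / real (card \<Omega>) * (\<Sum>i\<in>\<Omega>. deriv l (end_tensor N R w i - y i) * ?c i)"
    unfolding weight_gradient_def factorization_objective_def fun_upd_triv by (rule DERIV_imp_deriv)
  also have "\<dots> = (\<Sum>i\<in>\<Omega>. tensor_gradient (completion_loss l \<Omega> y) (end_tensor N R w) i * ?c i)"
    by (simp add: tensor_gradient_completion_loss[OF assms(1) fin] sum_distrib_left mult.assoc)
  \<comment> \<open>Unobserved entries contribute nothing, since the loss gradient vanishes
    there.\<close>
  also have "\<dots> = (\<Sum>i\<in>multi_indices N d.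
      tensor_gradient (completion_loss l \<Omega> y) (end_tensor N R w) i * ?c i)"
    using assms(2) by (intro sum.mono_neutral_left)
      (auto simp: finite_multi_indices tensor_gradient_completion_loss[OF assms(1) fin])
  finally show ?thesis .
qed

text \<open>Euler's identity in the block \<open>w r n\<close>: the right-hand side does not depend on \<open>n\<close>.\<close>

lemma sum_weight_gradient:
  assumes "\<And>x. l differentiable (at x)" and "\<Omega> \<subseteq> multi_indices N d"
    and "n \<in> {1..N}" "r \<in> {1..R}"
  shows "(\<Sum>j=1..d n. w r n j *
            weight_gradient (factorization_objective N R (completion_loss l \<Omega> y)) w r n j) =
         tensor_inner N d (tensor_gradient (completion_loss l \<Omega> y) (end_tensor N R w))
           (outer_product N (w r))"
proof -
  let ?G = "tensor_gradient (completion_loss l \<Omega> y) (end_tensor N R w)"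
  let ?p = "\<lambda>i. \<Prod>m\<in>{1..N}-{n}. w r m (i m)"
  have "(\<Sum>j=1..d n. w r n j *
            weight_gradient (factorization_objective N R (completion_loss l \<Omega> y)) w r n j) =
      (\<Sum>i\<in>multi_indices N d. \<Sum>j=1..d n. w r n j * (?G i * (if i n = j then ?p i else 0)))"
    unfolding weight_gradient_factorization_objective[OF assms] sum_distrib_left
    by (rule sum.swap)
  also have "\<dots> = (\<Sum>i\<in>multi_indices N d. ?G i * outer_product N (w r) i)"
  proof (rule sum.cong[OF refl])
    fix i assume "i \<in> multi_indices N d"
    then have "i n \<in> {1..d n}"
      using assms(3) by (auto simp: multi_indices_def PiE_iff)
    moreover have "(\<Sum>j=1..d n. w r n j * (?G i * (if i n = j then ?p i else 0))) =
        (\<Sum>j=1..d n. if i n = j then w r n j * (?G i * ?p i) else 0)"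
      by (intro sum.cong) auto
    ultimately have "(\<Sum>j=1..d n. w r n j * (?G i * (if i n = j then ?p i else 0))) =
        w r n (i n) * (?G i * ?p i)"
      by simp
    \<comment> \<open>The factor of mode \<open>n\<close> rejoins the product of the others, which
      removes every trace of \<open>n\<close>.\<close>
    also have "\<dots> = ?G i * outer_product N (w r) i"
      unfolding outer_product_def using assms(3) by (subst prod.remove[of _ n]) auto
    finally show "(\<Sum>j=1..d n. w r n j * (?G i * (if i n = j then ?p i else 0))) =
        ?G i * outer_product N (w r) i" .
  qed
  finally show ?thesis by (simp add: tensor_inner_def)
qed

section \<open>Conservation of differences of squared norms\<close>

lemma has_derivative_vec_norm_sq:
  assumes "gradient_flow N d R (factorization_objective N R (completion_loss l \<Omega> y)) w"
    and "\<And>x. l differentiable (at x)" and "\<Omega> \<subseteq> multi_indices N d"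
    and "n \<in> {1..N}" "r \<in> {1..R}" and "t \<ge> 0"
  shows "((\<lambda>s. (vec_norm (d n) (w s r n))\<^sup>2) has_real_derivative
           - 2 * tensor_inner N d (tensor_gradient (completion_loss l \<Omega> y) (end_tensor N R (w t)))
             (outer_product N (w t r))) (at t within {0..})"
proof -
  let ?g = "weight_gradient (factorization_objective N R (completion_loss l \<Omega> y)) (w t) r n"
  have "((\<lambda>s. \<Sum>j=1..d n. (w s r n j)\<^sup>2) has_real_derivative
      (\<Sum>j=1..d n. - 2 * (w t r n j * ?g j))) (at t within {0..})"
  proof (rule DERIV_sum)
    fix j assume "j \<in> {1..d n}"
    then have "((\<lambda>s. w s r n j) has_real_derivative - ?g j) (at t within {0..})"
      using assms(1,4-6) by (auto simp: gradient_flow_def)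
    from DERIV_power[OF this, of 2]
    show "((\<lambda>s. (w s r n j)\<^sup>2) has_real_derivative - 2 * (w t r n j * ?g j)) (at t within {0..})"
      by (simp add: mult_ac)
  qed
  then show ?thesis
    unfolding vec_norm_sq sum_distrib_left[symmetric] sum_weight_gradient[OF assms(2-5)] .
qed

lemma abs_vec_norm_sq_diff_le_unbalancedness:
  assumes "r \<in> {1..R}" "n \<in> {1..N}" "m \<in> {1..N}"
  shows "\<bar>(vec_norm (d n) (w r n))\<^sup>2 - (vec_norm (d m) (w r m))\<^sup>2\<bar> \<le> unbalancedness N d R w"
proof -
  let ?f = "\<lambda>(r, n, m). \<bar>(vec_norm (d n) (w r n))\<^sup>2 - (vec_norm (d m) (w r m))\<^sup>2\<bar>"
  let ?S = "{\<bar>(vec_norm (d n) (w r n))\<^sup>2 - (vec_norm (d m) (w r m))\<^sup>2\<bar> | r n m.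
            r \<in> {1..R} \<and> n \<in> {1..N} \<and> m \<in> {1..N}}"
  \<comment> \<open>\<open>Max\<close> is an upper bound only for a finite set; this inclusion in a
    finite image provides that.\<close>
  have "?S \<subseteq> ?f ` ({1..R} \<times> {1..N} \<times> {1..N})"
    by force
  then have "finite ?S"
    by (rule finite_subset) auto
  then show ?thesis
    unfolding unbalancedness_def using assms by (intro Max_ge) blast+
qed

text \<open>Both squared norms have the same derivative, by Euler's identity, so their difference
  has derivative zero on the convex set \<open>{0..}\<close>.\<close>

lemma vec_norm_sq_diff_conserved:
  assumes "gradient_flow N d R (factorization_objective N R (completion_loss l \<Omega> y)) w"
    and "\<And>x. l differentiable (at x)" and "\<Omega> \<subseteq> multi_indices N d"
    and "n \<in> {1..N}" "m \<in> {1..N}" "r \<in> {1..R}" and "t \<ge> 0"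
  shows "(vec_norm (d n) (w t r n))\<^sup>2 - (vec_norm (d m) (w t r m))\<^sup>2 =
         (vec_norm (d n) (w 0 r n))\<^sup>2 - (vec_norm (d m) (w 0 r m))\<^sup>2"
proof -
  let ?f = "\<lambda>s. (vec_norm (d n) (w s r n))\<^sup>2 - (vec_norm (d m) (w s r m))\<^sup>2"
  have "\<exists>c. \<forall>s\<in>{0..}. ?f s = c"
  proof (rule has_field_derivative_zero_constant)
    fix s :: real assume "s \<in> {0..}"
    then have "s \<ge> 0" by simp
    from DERIV_diff[OF has_derivative_vec_norm_sq[OF assms(1-3) assms(4,6) this]
        has_derivative_vec_norm_sq[OF assms(1-3) assms(5,6) this]]
    show "(?f has_real_derivative 0) (at s within {0..})" by simp
  qed simp
  then show ?thesis using assms(7) by force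
qed

section \<open>Elementary inequalities for positive families\<close>

lemma sq_le_prod_powr_plus:
  fixes a :: "'i \<Rightarrow> real"
  assumes "finite I" "\<And>n. n \<in> I \<Longrightarrow> 0 < a n"
    and "\<And>n m. n \<in> I \<Longrightarrow> m \<in> I \<Longrightarrow> \<bar>(a n)\<^sup>2 - (a m)\<^sup>2\<bar> \<le> e" and "m \<in> I"
  shows "(a m)\<^sup>2 \<le> (\<Prod>n\<in>I. a n) powr (2 / real (card I)) + e"
proof -
  let ?P = "\<Prod>n\<in>I. a n"
  let ?b = "?P powr (2 / real (card I))"
  have P: "?P > 0" using assms(2) by (rule prod_pos)
  have card: "card I > 0" using assms(1,4) card_gt_0_iff by blast
  \<comment> \<open>\<open>?b\<close> is the geometric mean of the squares, so they cannot all
    exceed it: multiplying the strict inequalities would give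
    \<open>?P\<^sup>2 < ?P\<^sup>2\<close>.\<close>
  have "\<exists>n\<in>I. (a n)\<^sup>2 \<le> ?b"
  proof (rule ccontr)
    assume "\<not> ?thesis"
    then have "(\<Prod>n\<in>I. ?b) < (\<Prod>n\<in>I. (a n)\<^sup>2)"
      using assms(1,4) by (intro prod_mono_strict) (force intro: less_imp_le)+
    moreover have "(\<Prod>n\<in>I. ?b) = ?P\<^sup>2"
      using P card powr_realpow[of ?b "card I"] by (simp add: powr_powr)
    ultimately show False by (simp add: prod_power_distrib)
  qed
  then show ?thesis using assms(3)[OF assms(4)] by fastforce
qed

text \<open>Each summand is a product of \<open>card I - 1\<close> squares bounded by
  \<open>M\<close>. Conversely, restoring the missing square costs a factor of at most
  \<open>M\<close> and yields the full squared product.\<close>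

lemma sum_prod_remove_sq_bounds:
  fixes a :: "'i \<Rightarrow> real"
  assumes "finite I" "\<And>n. n \<in> I \<Longrightarrow> 0 < a n" "\<And>n. n \<in> I \<Longrightarrow> (a n)\<^sup>2 \<le> M"
  shows "(\<Sum>n\<in>I. (\<Prod>m\<in>I-{n}. a m)\<^sup>2) \<le> real (card I) * M ^ (card I - 1)"
    and "real (card I) * ((\<Prod>n\<in>I. a n)\<^sup>2 / M) \<le> (\<Sum>n\<in>I. (\<Prod>m\<in>I-{n}. a m)\<^sup>2)"
proof -
  have "(\<Prod>m\<in>I-{n}. a m)\<^sup>2 \<le> M ^ (card I - 1)" if "n \<in> I" for n
  proof -
    have "(\<Prod>m\<in>I-{n}. (a m)\<^sup>2) \<le> (\<Prod>m\<in>I-{n}. M)"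
      using assms(3) by (intro prod_mono) auto
    then show ?thesis using that assms(1) by (simp add: prod_power_distrib)
  qed
  then show "(\<Sum>n\<in>I. (\<Prod>m\<in>I-{n}. a m)\<^sup>2) \<le> real (card I) * M ^ (card I - 1)"
    by (rule sum_bounded_above)
  have "(\<Prod>n\<in>I. a n)\<^sup>2 / M \<le> (\<Prod>m\<in>I-{n}. a m)\<^sup>2" if "n \<in> I" for n
  proof -
    have "(\<Prod>n\<in>I. a n)\<^sup>2 = (a n)\<^sup>2 * (\<Prod>m\<in>I-{n}. a m)\<^sup>2"
      using that assms(1) by (simp add: prod.remove[of I n] power_mult_distrib)
    also have "\<dots> \<le> M * (\<Prod>m\<in>I-{n}. a m)\<^sup>2"
      using assms(3)[OF that] by (intro mult_right_mono) auto
    finally have "(\<Prod>n\<in>I. a n)\<^sup>2 \<le> M * (\<Prod>m\<in>I-{n}. a m)\<^sup>2" .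
    moreover have "M > 0"
      using assms(2,3)[OF that] zero_less_power[of "a n" 2] by linarith
    ultimately show ?thesis by (simp add: divide_le_eq mult.commute)
  qed
  then show "real (card I) * ((\<Prod>n\<in>I. a n)\<^sup>2 / M) \<le> (\<Sum>n\<in>I. (\<Prod>m\<in>I-{n}. a m)\<^sup>2)"
    by (rule sum_bounded_below)
qed

section \<open>Derivative of the component norm\<close>

lemma has_field_derivative_prod_within:
  fixes f :: "'i \<Rightarrow> 'a::real_normed_field \<Rightarrow> 'a"
  assumes "\<And>n. n \<in> I \<Longrightarrow> (f n has_field_derivative f' n) (at x within S)"
  shows "((\<lambda>s. \<Prod>n\<in>I. f n s) has_field_derivative (\<Sum>n\<in>I. f' n * (\<Prod>m\<in>I-{n}. f m x)))
           (at x within S)"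
proof -
  have "((\<lambda>s. \<Prod>n\<in>I. f n s) has_derivative (\<lambda>h. \<Sum>n\<in>I. f' n * h * (\<Prod>m\<in>I-{n}. f m x)))
      (at x within S)"
    using assms unfolding has_field_derivative_def by (rule has_derivative_prod)
  then show ?thesis
    unfolding has_field_derivative_def by (simp add: mult_ac mult_commute_abs flip: sum_distrib_left)
qed

text \<open>Each mode norm has derivative \<open>?al * ?P / ?a n\<close>. In the product rule this
  meets the product of the other norms, which is itself \<open>?P / ?a n\<close>, hence the
  squares.\<close>

lemma has_derivative_component_norm:
  assumes flow: "gradient_flow N d R (factorization_objective N R (completion_loss l \<Omega> y)) w"
    and diff: "\<And>x. l differentiable (at x)" and sub: "\<Omega> \<subseteq> multi_indices N d"
    and r: "r \<in> {1..R}" and t: "t \<ge> 0"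
    and pos: "\<And>n. n \<in> {1..N} \<Longrightarrow> 0 < vec_norm (d n) (w t r n)"
  shows "((\<lambda>s. component_norm N d (w s) r) has_real_derivative
           alignment N d R (completion_loss l \<Omega> y) (w t) r *
           (\<Sum>n\<in>{1..N}. (\<Prod>m\<in>{1..N}-{n}. vec_norm (d m) (w t r m))\<^sup>2)) (at t within {0..})"
proof -
  let ?a = "\<lambda>n. vec_norm (d n) (w t r n)"
  let ?P = "\<Prod>n=1..N. ?a n"
  let ?al = "alignment N d R (completion_loss l \<Omega> y) (w t) r"
  let ?g = "tensor_inner N d (tensor_gradient (completion_loss l \<Omega> y) (end_tensor N R (w t)))
             (outer_product N (w t r))"
  have P: "?P > 0" using pos by (rule prod_pos)
  \<comment> \<open>Normalizing all vectors divides their outer product by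
    \<open>?P\<close>.\<close>
  have "?al = - (?g / ?P)"
    unfolding alignment_def tensor_inner_def outer_product_normalize_vecs
    by (simp add: sum_divide_distrib sum_negf)
  then have "?al = - ?g / ?P" by (rule trans) (rule minus_divide_left)
  then have g: "- ?g = ?al * ?P"
    using P nonzero_eq_divide_eq[of ?P ?al "- ?g"] by (metis less_irrefl)
  have a': "((\<lambda>s. vec_norm (d n) (w s r n)) has_real_derivative ?al * ?P / ?a n)
      (at t within {0..})" if n: "n \<in> {1..N}" for n
  proof -
    \<comment> \<open>The known derivative is that of the squared norm; positivity at
      \<open>t\<close> keeps the square root away from its singularity at 0.\<close>
    have "((\<lambda>s. sqrt ((vec_norm (d n) (w s r n))\<^sup>2)) has_real_derivative
        inverse (sqrt ((?a n)\<^sup>2)) / 2 * (- 2 * ?g)) (at t within {0..})"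
      using pos[OF n]
      by (intro DERIV_chain2[OF DERIV_real_sqrt has_derivative_vec_norm_sq[OF flow diff sub n r t]])
        simp
    moreover have "inverse (sqrt ((?a n)\<^sup>2)) / 2 * (- 2 * ?g) = (- ?g) / ?a n"
      using pos[OF n] by (simp add: field_simps)
    ultimately show ?thesis
      unfolding g by (simp add: vec_norm_nonneg)
  qed
  have "((\<lambda>s. \<Prod>n=1..N. vec_norm (d n) (w s r n)) has_real_derivative
      (\<Sum>n=1..N. ?al * ?P / ?a n * (\<Prod>m\<in>{1..N}-{n}. ?a m))) (at t within {0..})"
    by (rule has_field_derivative_prod_within[OF a'])
  moreover have "(\<Sum>n=1..N. ?al * ?P / ?a n * (\<Prod>m\<in>{1..N}-{n}. ?a m)) =
      ?al * (\<Sum>n=1..N. (\<Prod>m\<in>{1..N}-{n}. ?a m)\<^sup>2)"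
    unfolding sum_distrib_left
  proof (rule sum.cong[OF refl])
    fix n assume n: "n \<in> {1..N}"
    have "?P = ?a n * (\<Prod>m\<in>{1..N}-{n}. ?a m)"
      using n by (intro prod.remove) auto
    then show "?al * ?P / ?a n * (\<Prod>m\<in>{1..N}-{n}. ?a m) = ?al * (\<Prod>m\<in>{1..N}-{n}. ?a m)\<^sup>2"
      using pos[OF n] by (simp add: power2_eq_square)
  qed
  ultimately show ?thesis
    by (simp add: component_norm_def tensor_norm_outer_product)
qed

theorem theorem1:
  fixes N R :: nat
    and d :: "nat \<Rightarrow> nat"
    and l :: "real \<Rightarrow> real"
    and \<Omega> :: "(nat \<Rightarrow> nat) set"
    and y :: tensor
    and L :: "tensor \<Rightarrow> real"
    and w :: "real \<Rightarrow> weights"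
    and eps :: real
    and r :: nat
    and t :: real
  assumes "N \<ge> 3" and "\<forall>n\<in>{1..N}. d n \<ge> 1" and "R \<ge> 1"
    and "\<forall>x. l x \<ge> 0" and "locally_smooth l"
    and "\<Omega> \<noteq> {}" and "\<Omega> \<subseteq> multi_indices N d"
    and "L = completion_loss l \<Omega> y"
    and "gradient_flow N d R (factorization_objective N R L) w"
    and "unbalancedness N d R (w 0) = eps" and "eps \<ge> 0"
    and "r \<in> {1..R}" and "t \<ge> 0" and "component_norm N d (w t) r > 0"
  shows "\<exists>D. ((\<lambda>s. component_norm N d (w s) r) has_real_derivative D) (at t within {0..}) \<and>
    (alignment N d R L (w t) r \<ge> 0 \<longrightarrow>
       D \<le> real N * alignment N d R L (w t) r *
             (component_norm N d (w t) r powr (2 / real N) + eps) ^ (N - 1) \<and>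
       D \<ge> real N * alignment N d R L (w t) r *
             ((component_norm N d (w t) r)\<^sup>2 /
              (component_norm N d (w t) r powr (2 / real N) + eps))) \<and>
    (alignment N d R L (w t) r < 0 \<longrightarrow>
       D \<ge> real N * alignment N d R L (w t) r *
             (component_norm N d (w t) r powr (2 / real N) + eps) ^ (N - 1) \<and>
       D \<le> real N * alignment N d R L (w t) r *
             ((component_norm N d (w t) r)\<^sup>2 /
              (component_norm N d (w t) r powr (2 / real N) + eps)))"
proof -
  let ?a = "\<lambda>n. vec_norm (d n) (w t r n)"
  let ?al = "alignment N d R L (w t) r"
  let ?S = "\<Sum>n\<in>{1..N}. (\<Prod>m\<in>{1..N}-{n}. ?a m)\<^sup>2"
  let ?C = "component_norm N d (w t) r"
  let ?M = "?C powr (2 / real N) + eps"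
  note L = assms(8)
  note flow = assms(9)[unfolded L]
  have diff: "l differentiable (at x)" for x
    using assms(5) by (simp add: locally_smooth_def)
  have C: "?C = (\<Prod>n=1..N. ?a n)"
    by (simp add: component_norm_def tensor_norm_outer_product)
  \<comment> \<open>A positive product of nonnegative norms has no zero factor.\<close>
  have pos: "0 < ?a n" if "n \<in> {1..N}" for n
    using assms(14) that vec_norm_nonneg[of "d n" "w t r n"] unfolding C
    by (metis finite_atLeastAtMost order_le_less prod_zero_iff)
  \<comment> \<open>The bound holds at time 0 by the definition of unbalancedness, and conservation
    carries it to time \<open>t\<close>.\<close>
  have bal: "\<bar>(?a n)\<^sup>2 - (?a m)\<^sup>2\<bar> \<le> eps" if "n \<in> {1..N}" "m \<in> {1..N}" for n m
    using abs_vec_norm_sq_diff_le_unbalancedness[OF assms(12) that, of d "w 0"] assms(10)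
    by (simp add: vec_norm_sq_diff_conserved[OF flow diff assms(7) that assms(12,13)])
  have "(?a n)\<^sup>2 \<le> ?M" if "n \<in> {1..N}" for n
    using sq_le_prod_powr_plus[where I = "{1..N}" and a = ?a, OF _ pos bal that] unfolding C by simp
  from sum_prod_remove_sq_bounds[where I = "{1..N}" and a = ?a, OF _ pos this]
  have S: "?S \<le> real N * ?M ^ (N - 1)" "real N * (?C\<^sup>2 / ?M) \<le> ?S"
    by (simp_all add: C)
  have D: "((\<lambda>s. component_norm N d (w s) r) has_real_derivative ?al * ?S) (at t within {0..})"
    using has_derivative_component_norm[OF flow diff assms(7,12,13) pos] by (simp add: L)
  have *: "real N * ?al * x = ?al * (real N * x)" for x
    by simp
  \<comment> \<open>Both cases multiply the same two bounds on \<open>?S\<close> by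
    \<open>?al\<close>; a negative \<open>?al\<close> reverses them.\<close>
  show ?thesis
    unfolding * using D mult_left_mono[OF S(1)] mult_left_mono[OF S(2)]
      mult_left_mono_neg[OF S(1)] mult_left_mono_neg[OF S(2)]
    by (intro exI[of _ "?al * ?S"]) (blast intro: less_imp_le)
qed

end
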